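(* Let $n\ge 1$, let $\beta>0$ be fixed, and let $\alpha_k,\alpha^*_k>0$ for $k=1,\ldots,n$. Let $X_1,\ldots,X_n$ be independent random variables with $X_k\sim \mathcal{LFR}(\alpha_k,\beta)$, and let $Y_1,\ldots,Y_n$ be independent random variables with $Y_k\sim \mathcal{LFR}(\alpha^*_k,\beta)$, $k=1,\ldots,n$. If $\alpha^*_k\ge\alpha_k$ for every $k=1,\ldots,n$, then $X_{1:n}\le_{c}Y_{1:n}$.
   Context: For $\alpha,\beta>0$, a random variable $X$ has the linear failure rate distribution, written $X\sim\mathcal{LFR}(\alpha,\beta)$, if its cumulative distribution function is $F_X(x)=1-\exp\{-(\alpha x+\frac{\beta}{2}x^2)\}$ for $x>0$ (and $0$ for $x\le 0$). $X_{1:n}=\min\{X_1,\ldots,X_n\}$ and $Y_{1:n}=\min\{Y_1,\ldots,Y_n\}$ denote the smallest order statistics (lifetimes of series systems). For nonnegative absolutely continuous random variables $X,Y$ with cumulative distribution functions $F_X,G_Y$ and quantile function $G_Y^{-1}$ of $Y$, the convex transform order $X\le_{c}Y$ means that $x\mapsto G_Y^{-1}(F_X(x))$ is convex on $(0,\infty)$. *)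

theory Defs
  imports "HOL-Probability.Probability"
begin

definition rv_cdf :: "'a measure \<Rightarrow> ('a \<Rightarrow> real) \<Rightarrow> real \<Rightarrow> real" where
  "rv_cdf M X = cdf (distr M borel X)"

definition lfr_cdf :: "real \<Rightarrow> real \<Rightarrow> real \<Rightarrow> real" where
  "lfr_cdf \<alpha> \<beta> x = (if 0 < x then 1 - exp (- (\<alpha> * x + \<beta> / 2 * x\<^sup>2)) else 0)"

(* Intended for a probability space M and positive parameters; both are left to the
   user of the predicate. *)
definition lfr_distributed :: "'a measure \<Rightarrow> ('a \<Rightarrow> real) \<Rightarrow> real \<Rightarrow> real \<Rightarrow> bool" where
  "lfr_distributed M X \<alpha> \<beta> \<longleftrightarrow> X \<in> borel_measurable M \<and> rv_cdf M X = lfr_cdf \<alpha> \<beta>"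

(* Meaningful for n > 0: Min of the empty set is unspecified. *)
definition smallest_order_stat :: "nat \<Rightarrow> (nat \<Rightarrow> 'a \<Rightarrow> real) \<Rightarrow> 'a \<Rightarrow> real" where
  "smallest_order_stat n X \<omega> = Min ((\<lambda>k. X k \<omega>) ` {1..n})"

(* Generalized inverse of a distribution function. For 0 < u < 1 the set is nonempty and
   bounded below, so Inf is the true infimum; nothing is intended for other u. *)
definition quantile :: "(real \<Rightarrow> real) \<Rightarrow> real \<Rightarrow> real" where
  "quantile G u = Inf {x. u \<le> G x}"

(* Nonnegativity is almost sure, since only the laws of the variables matter. *)
definition nonneg_abs_cont_rv :: "'a measure \<Rightarrow> ('a \<Rightarrow> real) \<Rightarrow> bool" where
  "nonneg_abs_cont_rv M X \<longleftrightarrow>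
     X \<in> borel_measurable M \<and> (AE \<omega> in M. 0 \<le> X \<omega>) \<and>
     absolutely_continuous lborel (distr M borel X)"

(* The order is a relation between nonnegative absolutely continuous variables only, so
   membership in this class is part of the relation. The variables may live on different
   probability spaces. *)
definition convex_transform_le ::
    "'a measure \<Rightarrow> ('a \<Rightarrow> real) \<Rightarrow> 'b measure \<Rightarrow> ('b \<Rightarrow> real) \<Rightarrow> bool" where
  "convex_transform_le M X N Y \<longleftrightarrow>
     nonneg_abs_cont_rv M X \<and> nonneg_abs_cont_rv N Y \<and>
     convex_on {0<..} (\<lambda>x. quantile (rv_cdf N Y) (rv_cdf M X x))"

end

(* The minimum of independent LFR(alpha k, beta) variables is again LFR, with parameters
   a = sum of the alpha k and b = n beta. For two such laws with a common b the transform
   y = G^{-1}(F x) solves a' y + b y^2 / 2 = a x + b x^2 / 2; completing the square gives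
   b y + a' = sqrt ((b x + a)^2 + (a'^2 - a^2)). As a' >= a, the right-hand side is the
   modulus of a complex number depending affinely on x, hence convex in x. *)

theory Submission
  imports Defs
begin

lemma rv_cdf_eq_prob:
  assumes "X \<in> borel_measurable M"
  shows "rv_cdf M X x = measure M {\<omega> \<in> space M. X \<omega> \<le> x}"
  using assms unfolding rv_cdf_def cdf_def
  by (subst measure_distr) (auto intro!: arg_cong[where f = "measure M"])

lemma lfr_cdf_nonneg:
  assumes "0 \<le> a" "0 \<le> b"
  shows "0 \<le> lfr_cdf a b x"
proof (cases "0 < x")
  case True
  then have "0 \<le> a * x + b / 2 * x\<^sup>2"
    using assms by (intro add_nonneg_nonneg mult_nonneg_nonneg) auto
  then show ?thesis
    unfolding lfr_cdf_def by simp
qed (simp add: lfr_cdf_def)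

text \<open>The integrand is the failure rate \<open>a + b * x\<close> times the survival function,
  so on the positive half-line minus the survival function is an antiderivative. This supplies the
  candidate density for absolute continuity.\<close>

lemma nn_integral_lfr_density:
  assumes "0 < a" "0 < b"
  shows "(\<integral>\<^sup>+x. ennreal (indicator {0..} x * ((a + b * x) * exp (- (a * x + b / 2 * x\<^sup>2))))
            * indicator {..t} x \<partial>lborel) = ennreal (lfr_cdf a b t)"
proof (cases "0 < t")
  case True
  let ?f = "\<lambda>x. (a + b * x) * exp (- (a * x + b / 2 * x\<^sup>2))"
  have "(\<integral>\<^sup>+x. ennreal (indicator {0..} x * ?f x) * indicator {..t} x \<partial>lborel)
      = (\<integral>\<^sup>+x. ennreal (?f x) * indicator {0..t} x \<partial>lborel)"
    by (auto intro!: nn_integral_cong split: split_indicator)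
  also have "\<dots> = ennreal (- exp (- (a * t + b / 2 * t\<^sup>2)) - - exp (- (a * 0 + b / 2 * 0\<^sup>2)))"
  proof (rule nn_integral_FTC_Icc)
    show "((\<lambda>x. - exp (- (a * x + b / 2 * x\<^sup>2))) has_real_derivative ?f x) (at x)" for x
      by (auto intro!: derivative_eq_intros simp: algebra_simps power2_eq_square)
  qed (use assms True in auto)
  finally show ?thesis
    using True by (simp add: lfr_cdf_def)
next
  case False
  \<comment> \<open>For \<open>t = 0\<close> the two indicators still overlap at the point 0, so the
    integrand vanishes only almost everywhere.\<close>
  have "AE x in lborel. x \<noteq> (0::real)"
    by (rule AE_lborel_singleton)
  then have "AE x in lborel. ennreal (indicator {0..} x * ((a + b * x) * exp (- (a * x + b / 2 * x\<^sup>2))))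
      * indicator {..t} x = 0"
    by eventually_elim (use False in \<open>auto split: split_indicator\<close>)
  then show ?thesis
    using False by (simp add: lfr_cdf_def nn_integral_0_iff_AE)
qed

text \<open>A Borel law is determined by its values on the half-lines \<open>{..t}\<close>, and
  there the law of \<open>X\<close> agrees with the integrals of the explicit density.\<close>

lemma lfr_distributed_imp_nonneg_abs_cont_rv:
  assumes "prob_space M" and lfr: "lfr_distributed M X a b" and "0 < a" "0 < b"
  shows "nonneg_abs_cont_rv M X"
proof -
  interpret prob_space M by fact
  have X[measurable]: "X \<in> borel_measurable M" and cdf: "rv_cdf M X = lfr_cdf a b"
    using lfr by (auto simp: lfr_distributed_def)
  have prob: "prob {\<omega> \<in> space M. X \<omega> \<le> t} = lfr_cdf a b t" for t
    using rv_cdf_eq_prob[OF X, of t] cdf by simp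
  \<comment> \<open>The distribution function is 0 at 0, so the event
    \<open>X \<omega> \<le> 0\<close> is null.\<close>
  have "AE \<omega> in M. \<not> X \<omega> \<le> 0"
    using prob[of 0] by (subst prob_Collect_eq_0[symmetric]) (auto simp: lfr_cdf_def)
  then have nonneg: "AE \<omega> in M. 0 \<le> X \<omega>"
    by eventually_elim auto
  let ?f = "\<lambda>x. indicator {0..} x * ((a + b * x) * exp (- (a * x + b / 2 * x\<^sup>2)))"
  have "distributed M lborel X ?f"
  proof (rule distributedI_borel_atMost)
    show "emeasure M {\<omega> \<in> space M. X \<omega> \<le> t} = ennreal (lfr_cdf a b t)" for t
      by (simp add: emeasure_eq_measure prob)
    show "(\<integral>\<^sup>+x. ennreal (?f x * indicator {..t} x) \<partial>lborel) = ennreal (lfr_cdf a b t)" for t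
      using nn_integral_lfr_density[OF assms(3,4), of t]
      by (simp add: ennreal_mult'' ennreal_indicator)
  qed (use assms in \<open>auto intro!: mult_nonneg_nonneg split: split_indicator\<close>)
  then have "distr M lborel X = density lborel ?f"
    by (rule distributed_distr_eq_density)
  moreover have "distr M borel X = distr M lborel X"
    by (rule distr_cong) auto
  ultimately have "absolutely_continuous lborel (distr M borel X)"
    by (simp add: absolutely_continuousI_density)
  with nonneg X show ?thesis
    by (simp add: nonneg_abs_cont_rv_def)
qed

text \<open>By independence the survival function of the minimum is the product of the survival
  functions, and the exponents add up.\<close>

lemma lfr_distributed_smallest_order_stat:
  assumes "prob_space M" and "1 \<le> n"
    and indep: "prob_space.indep_vars M (\<lambda>_. borel) X {1..n}"
    and lfr: "\<And>k. k \<in> {1..n} \<Longrightarrow> lfr_distributed M (X k) (\<alpha> k) \<beta>"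
  shows "lfr_distributed M (smallest_order_stat n X) (\<Sum>k = 1..n. \<alpha> k) (n * \<beta>)"
proof -
  interpret prob_space M by fact
  have ne: "{1..n} \<noteq> {}"
    using \<open>1 \<le> n\<close> by auto
  have X[measurable]: "X k \<in> borel_measurable M"
    and cdf: "rv_cdf M (X k) = lfr_cdf (\<alpha> k) \<beta>" if "k \<in> {1..n}" for k
    using lfr[OF that] by (auto simp: lfr_distributed_def)
  have Z: "smallest_order_stat n X \<in> borel_measurable M"
    unfolding smallest_order_stat_def[abs_def] using X by (intro borel_measurable_Min) auto
  have gt: "prob {\<omega> \<in> space M. t < W \<omega>} = 1 - rv_cdf M W t" if "W \<in> borel_measurable M" for W t
  proof -
    have "{\<omega> \<in> space M. t < W \<omega>} = space M - {\<omega> \<in> space M. W \<omega> \<le> t}"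
      by auto
    then show ?thesis
      using that by (simp add: prob_compl rv_cdf_eq_prob)
  qed
  have "rv_cdf M (smallest_order_stat n X) t = lfr_cdf (\<Sum>k = 1..n. \<alpha> k) (n * \<beta>) t" for t
  proof -
    have "1 - rv_cdf M (smallest_order_stat n X) t = prob {\<omega> \<in> space M. t < smallest_order_stat n X \<omega>}"
      by (simp add: gt[OF Z])
    also have "{\<omega> \<in> space M. t < smallest_order_stat n X \<omega>} = (\<Inter>k\<in>{1..n}. X k -` {t<..} \<inter> space M)"
      using ne by (auto simp: smallest_order_stat_def)
    also have "prob \<dots> = (\<Prod>k = 1..n. prob (X k -` {t<..} \<inter> space M))"
      by (rule indep_varsD_finite[OF indep]) (use ne in auto)
    also have "\<dots> = (\<Prod>k = 1..n. 1 - lfr_cdf (\<alpha> k) \<beta> t)"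
    proof (rule prod.cong)
      fix k assume k: "k \<in> {1..n}"
      have "X k -` {t<..} \<inter> space M = {\<omega> \<in> space M. t < X k \<omega>}"
        by auto
      then show "prob (X k -` {t<..} \<inter> space M) = 1 - lfr_cdf (\<alpha> k) \<beta> t"
        by (simp add: gt[OF X[OF k]] cdf[OF k])
    qed simp
    \<comment> \<open>For \<open>t > 0\<close> a product of exponentials becomes the exponential of
      a sum; for \<open>t \<le> 0\<close> both sides are 1.\<close>
    also have "\<dots> = 1 - lfr_cdf (\<Sum>k = 1..n. \<alpha> k) (n * \<beta>) t"
      by (simp add: lfr_cdf_def exp_sum[symmetric] sum.distrib sum_negf sum_subtractf sum_distrib_right)
    finally show ?thesis
      by simp
  qed
  with Z show ?thesis
    by (auto simp: lfr_distributed_def)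
qed

text \<open>Completing the square exhibits the set whose infimum defines the quantile as a closed
  half-line, so that its endpoint can be read off without inverting \<open>lfr_cdf\<close>.\<close>

lemma lfr_cdf_le_iff:
  assumes "0 < a" "0 < a'" "0 < b" "0 < x"
  shows "lfr_cdf a b x \<le> lfr_cdf a' b y \<longleftrightarrow>
    (sqrt ((b * x + a)\<^sup>2 + (a'\<^sup>2 - a\<^sup>2)) - a') / b \<le> y"
proof (cases "0 < y")
  case True
  have "lfr_cdf a b x \<le> lfr_cdf a' b y \<longleftrightarrow> a * x + b / 2 * x\<^sup>2 \<le> a' * y + b / 2 * y\<^sup>2"
    using True assms unfolding lfr_cdf_def by auto
  \<comment> \<open>The factor \<open>2 * b\<close> turns the two exponents into
    \<open>(b * x + a)\<^sup>2 - a\<^sup>2\<close> and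
    \<open>(b * y + a')\<^sup>2 - a'\<^sup>2\<close>.\<close>
  also have "\<dots> \<longleftrightarrow> 2 * b * (a * x + b / 2 * x\<^sup>2) \<le> 2 * b * (a' * y + b / 2 * y\<^sup>2)"
    using assms by (intro mult_le_cancel_left_pos[symmetric]) auto
  also have "\<dots> \<longleftrightarrow> (b * x + a)\<^sup>2 + (a'\<^sup>2 - a\<^sup>2) \<le> (b * y + a')\<^sup>2"
    by (simp add: power2_eq_square algebra_simps)
  also have "\<dots> \<longleftrightarrow> sqrt ((b * x + a)\<^sup>2 + (a'\<^sup>2 - a\<^sup>2)) \<le> \<bar>b * y + a'\<bar>"
    using real_sqrt_le_iff[of _ "(b * y + a')\<^sup>2"] by simp
  also have "\<dots> \<longleftrightarrow> (sqrt ((b * x + a)\<^sup>2 + (a'\<^sup>2 - a\<^sup>2)) - a') / b \<le> y"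
    using True assms by (simp add: field_simps abs_of_pos add_pos_pos)
  finally show ?thesis .
next
  case False
  \<comment> \<open>Both sides fail for \<open>y \<le> 0\<close>: the left-hand value is positive
    while \<open>lfr_cdf a' b y\<close> is 0, and the root exceeds \<open>a'\<close>, so the bound
    on \<open>y\<close> is positive.\<close>
  have "0 < a * x + b / 2 * x\<^sup>2"
    using assms by (intro add_pos_pos) auto
  then have "\<not> lfr_cdf a b x \<le> lfr_cdf a' b y"
    using False assms by (simp add: lfr_cdf_def)
  moreover have "a'\<^sup>2 < (b * x + a)\<^sup>2 + (a'\<^sup>2 - a\<^sup>2)"
    using assms power_strict_mono[of a "b * x + a" 2] by simp
  then have "a' < sqrt ((b * x + a)\<^sup>2 + (a'\<^sup>2 - a\<^sup>2))"
    by (rule real_less_rsqrt)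
  then have "y < (sqrt ((b * x + a)\<^sup>2 + (a'\<^sup>2 - a\<^sup>2)) - a') / b"
    using False assms by (intro order.strict_trans1[of y 0]) auto
  ultimately show ?thesis
    by simp
qed

lemma quantile_lfr_cdf:
  assumes "0 < a" "0 < a'" "0 < b" "0 < x"
  shows "quantile (lfr_cdf a' b) (lfr_cdf a b x) = (sqrt ((b * x + a)\<^sup>2 + (a'\<^sup>2 - a\<^sup>2)) - a') / b"
proof -
  have "{y. lfr_cdf a b x \<le> lfr_cdf a' b y} = {(sqrt ((b * x + a)\<^sup>2 + (a'\<^sup>2 - a\<^sup>2)) - a') / b..}"
    using lfr_cdf_le_iff[OF assms] by auto
  then show ?thesis
    by (simp add: quantile_def)
qed

text \<open>For \<open>c \<ge> 0\<close> the root is the norm of a point moving affinely with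
  \<open>x\<close>, and the triangle inequality makes norms convex.\<close>

lemma convex_on_sqrt_square_plus:
  fixes a b c :: real
  assumes "0 \<le> c" "convex S"
  shows "convex_on S (\<lambda>x. sqrt ((b * x + a)\<^sup>2 + c))"
proof (rule convex_onI)
  define z where "z x = Complex (b * x + a) (sqrt c)" for x
  have z: "sqrt ((b * x + a)\<^sup>2 + c) = cmod (z x)" for x
    using assms by (simp add: z_def cmod_def)
  fix t x y :: real
  assume t: "0 < t" "t < 1"
  \<comment> \<open>The constant imaginary part \<open>sqrt c\<close> is preserved because the
    weights sum to 1.\<close>
  have "z ((1 - t) *\<^sub>R x + t *\<^sub>R y) = (1 - t) *\<^sub>R z x + t *\<^sub>R z y"
    by (simp add: z_def complex_eq_iff algebra_simps)
  also have "cmod \<dots> \<le> cmod ((1 - t) *\<^sub>R z x) + cmod (t *\<^sub>R z y)"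
    by (rule norm_triangle_ineq)
  also have "\<dots> = (1 - t) * cmod (z x) + t * cmod (z y)"
    using t by simp
  finally show "sqrt ((b * ((1 - t) *\<^sub>R x + t *\<^sub>R y) + a)\<^sup>2 + c)
      \<le> (1 - t) * sqrt ((b * x + a)\<^sup>2 + c) + t * sqrt ((b * y + a)\<^sup>2 + c)"
    by (simp only: z)
qed fact

lemma convex_on_quantile_lfr_cdf:
  assumes "0 < a" "a \<le> a'" "0 < b"
  shows "convex_on {0<..} (\<lambda>x. quantile (lfr_cdf a' b) (lfr_cdf a b x))"
proof -
  \<comment> \<open>The ordering of the parameters gives the constant under the root the sign that
    convexity requires.\<close>
  have "a\<^sup>2 \<le> a'\<^sup>2"
    using assms by (intro power_mono) auto
  then have "convex_on {0<..} (\<lambda>x. sqrt ((b * x + a)\<^sup>2 + (a'\<^sup>2 - a\<^sup>2)))"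
    by (intro convex_on_sqrt_square_plus) auto
  then have "convex_on {0<..} (\<lambda>x. (sqrt ((b * x + a)\<^sup>2 + (a'\<^sup>2 - a\<^sup>2)) + - a') / b)"
    using assms by (intro convex_on_cdiv convex_on_add) (auto simp: convex_on_const)
  then show ?thesis
    \<comment> \<open>The closed form of the quantile holds only at positive points;
      \<open>convex_def\<close> keeps the convex combinations inside \<open>{0<..}\<close>, so it
      applies to them too.\<close>
    using assms by (simp add: convex_on_def quantile_lfr_cdf convex_def)
qed

theorem theorem4p3:
  fixes M :: "'a measure" and N :: "'b measure"
    and X :: "nat \<Rightarrow> 'a \<Rightarrow> real" and Y :: "nat \<Rightarrow> 'b \<Rightarrow> real"
    and n :: nat and \<beta> :: real and \<alpha> \<alpha>' :: "nat \<Rightarrow> real"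
  assumes "prob_space M" and "prob_space N"
    and "1 \<le> n"
    and "0 < \<beta>"
    and "\<And>k. k \<in> {1..n} \<Longrightarrow> 0 < \<alpha> k"
    and "\<And>k. k \<in> {1..n} \<Longrightarrow> 0 < \<alpha>' k"
    and "prob_space.indep_vars M (\<lambda>_. borel) X {1..n}"
    and "\<And>k. k \<in> {1..n} \<Longrightarrow> lfr_distributed M (X k) (\<alpha> k) \<beta>"
    and "prob_space.indep_vars N (\<lambda>_. borel) Y {1..n}"
    and "\<And>k. k \<in> {1..n} \<Longrightarrow> lfr_distributed N (Y k) (\<alpha>' k) \<beta>"
    and "\<And>k. k \<in> {1..n} \<Longrightarrow> \<alpha> k \<le> \<alpha>' k"
  shows "convex_transform_le M (smallest_order_stat n X) N (smallest_order_stat n Y)"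
proof -
  \<comment> \<open>Since \<beta> is common to all components, both minima share the quadratic
    parameter \<open>b\<close>; the claim reduces to two single LFR laws that differ only in
    \<open>a\<close> and \<open>a'\<close>.\<close>
  define a a' b where "a = (\<Sum>k = 1..n. \<alpha> k)" and "a' = (\<Sum>k = 1..n. \<alpha>' k)" and "b = n * \<beta>"
  have "{1..n} \<noteq> {}"
    using assms(3) by auto
  then have "0 < a"
    unfolding a_def using assms(5) by (intro sum_pos) auto
  moreover have "a \<le> a'"
    unfolding a_def a'_def using assms(11) by (rule sum_mono)
  moreover have "0 < b"
    using assms(3,4) by (simp add: b_def)
  moreover have X: "lfr_distributed M (smallest_order_stat n X) a b"
    unfolding a_def b_def using assms by (intro lfr_distributed_smallest_order_stat) auto
  moreover have Y: "lfr_distributed N (smallest_order_stat n Y) a' b"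
    unfolding a'_def b_def using assms by (intro lfr_distributed_smallest_order_stat) auto
  ultimately have "nonneg_abs_cont_rv M (smallest_order_stat n X)"
    and "nonneg_abs_cont_rv N (smallest_order_stat n Y)"
    and "convex_on {0<..} (\<lambda>x. quantile (lfr_cdf a' b) (lfr_cdf a b x))"
    using lfr_distributed_imp_nonneg_abs_cont_rv[OF assms(1) X]
      lfr_distributed_imp_nonneg_abs_cont_rv[OF assms(2) Y] convex_on_quantile_lfr_cdf
    by auto
  with X Y show ?thesis
    by (simp add: convex_transform_le_def lfr_distributed_def)
qed


end
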